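(* The minimum abelian period of any (nonempty) factor of the infinite Fibonacci word is a Fibonacci number.
   Context: Fibonacci numbers: $F_0=1$, $F_1=1$, $F_{j+1}=F_j+F_{j-1}$ for $j\geq1$. The infinite Fibonacci word $f=abaababaabaab\cdots$ is the limit of the finite words $f_0=b$, $f_1=a$, $f_j=f_{j-1}f_{j-2}$ for $j>1$ (equivalently, the Sturmian word of angle and initial point $\phi-1$, $\phi=(1+\sqrt5)/2$). A factor is a finite contiguous subword. The Parikh vector $\mathcal P$ of a word over $\{a,b\}$ is the pair (number of $a$'s, number of $b$'s), with norm $|\mathcal P|$ the sum of its components; $\mathcal P$ is contained in $\mathcal Q$ if $|\mathcal P|<|\mathcal Q|$ and $\mathcal P\leq\mathcal Q$ componentwise. An integer $m$ is an abelian period of a word $w$ if $w=u_0u_1\cdots u_{j-1}u_j$ for some $j\geq2$, where $u_1,\dots,u_{j-1}$ all have the same Parikh vector $\mathcal P$ of norm $m$, and the Parikh vectors of $u_0$ and $u_j$ (possibly empty words) are contained in $\mathcal P$. The minimum abelian period of $w$ is the smallest such $m$. *)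

theory Defs
  imports "HOL-Number_Theory.Fib" "HOL-Library.Omega_Words_Fun" "HOL-Library.Sublist"
begin

(* The Fibonacci numbers F 0 = F 1 = 1, F (j + 1) = F j + F (j - 1) are F j = fib (Suc j) in
   terms of the library function, which starts with fib 0 = 0, fib 1 = 1.  In particular 0 is
   not one of them. *)

datatype letter = A | B

fun fib_word :: "nat \<Rightarrow> letter list" where
  "fib_word 0 = [B]"
| "fib_word (Suc 0) = [A]"
| "fib_word (Suc (Suc n)) = fib_word (Suc n) @ fib_word n"

(* Convergence of finite words to an infinite word: each position is eventually defined and
   eventually carries the letter of the limit. *)
definition words_converge :: "(nat \<Rightarrow> 'a list) \<Rightarrow> 'a word \<Rightarrow> bool" where
  "words_converge w x \<longleftrightarrow>
     (\<forall>i. \<forall>\<^sub>F n in sequentially. i < length (w n) \<and> w n ! i = x i)"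

definition inf_fib_word :: "letter word" where
  "inf_fib_word = (THE x. words_converge fib_word x)"

definition is_factor :: "'a list \<Rightarrow> 'a word \<Rightarrow> bool" where
  "is_factor w x \<longleftrightarrow> (\<exists>i j. w = x [i \<rightarrow> j])"

definition parikh :: "letter list \<Rightarrow> nat \<times> nat" where
  "parikh w = (count_list w A, count_list w B)"

definition parikh_norm :: "nat \<times> nat \<Rightarrow> nat" where
  "parikh_norm P = fst P + snd P"

definition parikh_contained :: "nat \<times> nat \<Rightarrow> nat \<times> nat \<Rightarrow> bool" where
  "parikh_contained P Q \<longleftrightarrow>
     parikh_norm P < parikh_norm Q \<and> fst P \<le> fst Q \<and> snd P \<le> snd Q"

definition abelian_period :: "nat \<Rightarrow> letter list \<Rightarrow> bool" where
  "abelian_period m w \<longleftrightarrow>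
     (\<exists>j\<ge>2. \<exists>(u :: nat \<Rightarrow> letter list) P.
        w = concat (map u [0..<Suc j]) \<and>
        parikh_norm P = m \<and>
        (\<forall>i\<in>{1..j - 1}. parikh (u i) = P) \<and>
        parikh_contained (parikh (u 0)) P \<and>
        parikh_contained (parikh (u j)) P)"

(* Only meaningful for nonempty words: the empty word has no abelian period. *)
definition min_abelian_period :: "letter list \<Rightarrow> nat" where
  "min_abelian_period w = (LEAST m. abelian_period m w)"


lemma words_converge_unique:
  assumes "words_converge w x" "words_converge w y"
  shows "x = y"
proof
  fix i
  have "\<forall>\<^sub>F n in sequentially. i < length (w n) \<and> w n ! i = x i"
    and "\<forall>\<^sub>F n in sequentially. i < length (w n) \<and> w n ! i = y i"
    using assms by (auto simp: words_converge_def)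
  then have "\<forall>\<^sub>F n in sequentially. x i = y i"
    by eventually_elim auto
  then show "x i = y i" by simp
qed

lemma length_fib_word: "length (fib_word n) = fib (Suc n)"
  by (induction n rule: fib_word.induct) auto

lemma fib_word_longer: "i < length (fib_word (Suc (Suc i)))"
proof (induction i)
  case (Suc i)
  have "length (fib_word (Suc i)) > 0"
    by (simp add: length_fib_word fib_neq_0_nat del: fib.simps)
  moreover have "length (fib_word (Suc (Suc (Suc i)))) =
      length (fib_word (Suc (Suc i))) + length (fib_word (Suc i))"
    by (subst fib_word.simps(3)) (rule length_append)
  ultimately show ?case using Suc by linarith
qed simp

lemma fib_word_prefix:
  assumes "m \<ge> 1" "m \<le> n"
  shows "Sublist.prefix (fib_word m) (fib_word n)"
  using assms(2)
proof (induction rule: dec_induct)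
  case (step n)
  then obtain k where "n = Suc k"
    using assms(1) by (cases n) auto
  then show ?case
    using step by auto
qed simp

lemma inf_fib_word_limit: "words_converge fib_word inf_fib_word"
proof -
  define x where "x = (\<lambda>i. fib_word (Suc (Suc i)) ! i)"
  have "words_converge fib_word x"
    unfolding words_converge_def eventually_sequentially
  proof (intro allI exI impI)
    fix i n :: nat
    assume "Suc (Suc i) \<le> n"
    then have "Sublist.prefix (fib_word (Suc (Suc i))) (fib_word n)"
      by (intro fib_word_prefix) auto
    then obtain z where "fib_word n = fib_word (Suc (Suc i)) @ z"
      by (auto simp only: Sublist.prefix_def)
    then show "i < length (fib_word n) \<and> fib_word n ! i = x i"
      using fib_word_longer[of i] by (simp add: x_def nth_append del: fib_word.simps)
  qed
  then show ?thesis
    unfolding inf_fib_word_def by (metis theI words_converge_unique)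
qed

lemma parikh_norm_parikh: "parikh_norm (parikh w) = length w"
proof (induction w)
  case (Cons c w)
  then show ?case by (cases c) (auto simp: parikh_norm_def parikh_def)
qed (simp add: parikh_norm_def parikh_def)

lemma abelian_period_length:
  assumes "w \<noteq> []"
  shows "abelian_period (length w) w"
proof -
  let ?u = "\<lambda>i::nat. if i = 1 then w else []"
  have "w = concat (map ?u [0..<Suc 2])"
    by (simp add: numeral_2_eq_2)
  moreover have "parikh_contained (parikh []) (parikh w)"
    using assms parikh_norm_parikh[of w]
    by (simp add: parikh_contained_def parikh_norm_def parikh_def)
  ultimately show ?thesis
    unfolding abelian_period_def
    by (intro exI[of _ 2] exI[of _ ?u] exI[of _ "parikh w"] conjI)
       (auto simp: parikh_norm_parikh)
qed

lemma abelian_period_min_abelian_period: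
  assumes "w \<noteq> []"
  shows "abelian_period (min_abelian_period w) w"
  unfolding min_abelian_period_def by (rule LeastI, rule abelian_period_length[OF assms])

end

theory Submission
  imports Defs
begin

text \<open>
  The number of letters \<open>A\<close> among the first \<open>n\<close> letters of the Fibonacci word is
  \<open>\<lfloor>(n + 1) * \<alpha>\<rfloor>\<close> for the inverse golden ratio \<open>\<alpha>\<close>.  Suppose that a factor \<open>w\<close> has an abelian
  period \<open>m\<close> strictly between consecutive Fibonacci numbers \<open>F < G\<close>.  As \<open>m\<close> is not a Fibonacci
  number, \<open>m * \<alpha>\<close> is far from the integers, so only few consecutive blocks of length \<open>m\<close> have equal
  Parikh vectors, and \<open>w\<close> is short.  On the other hand \<open>F * \<alpha>\<close> is very close to an integer: blocks
  of length \<open>F\<close> all have the same Parikh vector except those at exceptional positions, and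
  these are at least \<open>G\<close> apart by the best approximation property of \<open>\<alpha>\<close>.  The short word \<open>w\<close> has
  too few of them to hit every residue class modulo \<open>F\<close>, so \<open>F\<close> is an abelian period as well.
\<close>

section \<open>Diophantine approximation of the inverse golden ratio\<close>

definition inv_phi :: real where
  "inv_phi = (sqrt 5 - 1) / 2"

lemma inv_phi_sq: "inv_phi\<^sup>2 = 1 - inv_phi"
proof -
  have "(sqrt 5)\<^sup>2 = (5::real)" by simp
  then show ?thesis unfolding inv_phi_def by (simp add: power2_eq_square field_simps)
qed

text \<open>The bounds are the consecutive convergents \<open>fib 6 / fib 7\<close> and
  \<open>fib 7 / fib 8\<close>, sharp enough for all numerical comparisons below.\<close>

lemma inv_phi_bounds: "8/13 < inv_phi" "inv_phi < 13/21"
proof -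
  have "29/13 < sqrt 5" by (rule real_less_rsqrt) (simp add: power2_eq_square)
  then show "8/13 < inv_phi" by (simp add: inv_phi_def)
  have "sqrt 5 < 47/21" by (rule real_less_lsqrt) (simp_all add: power2_eq_square)
  then show "inv_phi < 13/21" by (simp add: inv_phi_def)
qed

lemma inv_phi_pos: "0 < inv_phi" and inv_phi_less_1: "inv_phi < 1"
  using inv_phi_bounds by linarith+

lemma inv_phi_power_pos: "0 < inv_phi ^ k"
  using inv_phi_pos by simp

lemma inv_phi_power_Suc_Suc: "inv_phi ^ Suc (Suc k) = inv_phi ^ k - inv_phi ^ Suc k"
proof -
  have "inv_phi ^ Suc (Suc k) = inv_phi ^ k * inv_phi\<^sup>2"
    by (simp add: power2_eq_square)
  then show ?thesis by (simp add: inv_phi_sq algebra_simps)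
qed

text \<open>This is the signed error of a convergent. Since \<open>- inv_phi\<close> is a root of
  x^2 = x + 1, both sides satisfy the Fibonacci recurrence.\<close>

lemma fib_mult_inv_phi: "fib (Suc k) * inv_phi - fib k = (-1) ^ k * inv_phi ^ Suc k"
proof (induction k rule: fib.induct)
  case (3 k)
  have "fib (Suc (Suc (Suc k))) * inv_phi - fib (Suc (Suc k)) =
      (fib (Suc k) * inv_phi - fib k) + (fib (Suc (Suc k)) * inv_phi - fib (Suc k))"
    by (simp add: algebra_simps)
  also have "\<dots> = (-1) ^ k * (inv_phi ^ Suc k - inv_phi ^ Suc (Suc k))"
    unfolding 3 by (simp add: algebra_simps)
  also have "\<dots> = (-1) ^ Suc (Suc k) * inv_phi ^ Suc (Suc (Suc k))"
    by (subst inv_phi_power_Suc_Suc) simp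
  finally show ?case .
qed (use inv_phi_sq in \<open>simp_all add: power2_eq_square\<close>)

text \<open>Consecutive convergents form a basis of the integer lattice, in which the distance
  \<open>n * inv_phi - p\<close> factorizes.\<close>

lemma convergent_coordinates:
  fixes n p :: int
  obtains x y :: int where "n = x * fib (Suc k) + y * fib k"
    and "n * inv_phi - p = (- inv_phi) ^ k * (x * inv_phi - y)"
proof -
  have "\<exists>(x::int) (y::int). n = x * fib (Suc k) + y * fib k \<and>
      n * inv_phi - p = (- inv_phi) ^ k * (x * inv_phi - y)"
  proof (induction k)
    case 0
    show ?case by (rule exI[of _ n], rule exI[of _ p]) simp
  next
    case (Suc k)
    then obtain x y :: int where xy: "n = x * fib (Suc k) + y * fib k"
      "n * inv_phi - p = (- inv_phi) ^ k * (x * inv_phi - y)" by blast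
    \<comment> \<open>The new coordinates \<open>y\<close> and \<open>x - y\<close> come from
      substituting \<open>fib (Suc (Suc k)) - fib (Suc k)\<close> for \<open>fib k\<close>.\<close>
    have "- inv_phi * (y * inv_phi - (x - y)) = x * inv_phi - y * (inv_phi\<^sup>2 + inv_phi)"
      by (simp add: algebra_simps power2_eq_square)
    then have "- inv_phi * (y * inv_phi - (x - y)) = x * inv_phi - y"
      by (simp add: inv_phi_sq)
    then have "(- inv_phi) ^ Suc k * (y * inv_phi - (x - y)) = n * inv_phi - p"
      unfolding xy(2) power_Suc2 mult.assoc by simp
    moreover have "n = y * fib (Suc (Suc k)) + (x - y) * fib (Suc k)"
      unfolding xy(1) by (simp add: algebra_simps)
    ultimately show ?case by (intro exI[of _ y] exI[of _ "x - y"]) simp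
  qed
  then show thesis using that by blast
qed

text \<open>Used for coordinates of opposite signs: there \<open>x * c\<close> and
  \<open>- y\<close> cannot cancel.\<close>

lemma abs_diff_opposite_signs:
  fixes x y :: int and c :: real
  assumes "c \<ge> 0" "x \<ge> a \<and> y \<le> - b \<or> x \<le> - a \<and> y \<ge> b"
  shows "\<bar>x * c - y\<bar> \<ge> a * c + b"
  using assms(2)
proof
  assume *: "x \<ge> a \<and> y \<le> - b"
  then have "real_of_int a * c \<le> x * c" using assms(1) by (intro mult_right_mono) auto
  with * show ?thesis by linarith
next
  assume *: "x \<le> - a \<and> y \<ge> b"
  then have "x * c \<le> real_of_int (- a) * c"
    using assms(1) by (intro mult_right_mono) (auto simp del: of_int_minus)
  with * have "x * c \<le> - (real_of_int a * c)" "real_of_int b \<le> y" by simp_all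
  then show ?thesis by linarith
qed

text \<open>A nonzero \<open>n\<close> of absolute value below \<open>fib (Suc k)\<close> has
  convergent coordinates with \<open>y\<close> nonzero and \<open>x\<close> zero or of the opposite
  sign; otherwise it would be zero or too large. Hence the second factor of the distance is at least
  1.\<close>

lemma fib_best_approximation:
  fixes n p :: int
  assumes "n \<noteq> 0" "\<bar>n\<bar> < fib (Suc k)"
  shows "inv_phi ^ k \<le> \<bar>n * inv_phi - p\<bar>"
proof -
  obtain x y :: int where n: "n = x * fib (Suc k) + y * fib k"
    and d: "n * inv_phi - p = (- inv_phi) ^ k * (x * inv_phi - y)"
    using convergent_coordinates by blast
  define F G where "F = int (fib k)" and "G = int (fib (Suc k))"
  have FG: "F \<ge> 0" "G > 0" by (auto simp: F_def G_def fib_neq_0_nat)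
  have n': "n = x * G + y * F" using n by (simp add: F_def G_def)
  have bd: "- G < n" "n < G" using assms(2) by (auto simp: G_def)
  have "x \<ge> 0 \<and> y \<le> - 1 \<or> x \<le> - 0 \<and> y \<ge> 1"
  proof (rule ccontr)
    assume "\<not> ?thesis"
    then consider "x \<ge> 1" "y \<ge> 0" | "x \<le> - 1" "y \<le> 0" | "x = 0" "y = 0" by linarith
    then show False
    proof cases
      case 1
      then have "1 * G \<le> x * G" "0 \<le> y * F" using FG by (auto simp del: mult_1)
      with bd n' show False by linarith
    next
      case 2
      then have "x * G \<le> - 1 * G" "y * F \<le> 0 * F"
        using FG by (intro mult_right_mono; simp)+
      with bd n' show False by linarith
    qed (use assms(1) n in simp)
  qed
  from abs_diff_opposite_signs[OF _ this, of inv_phi] inv_phi_pos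
  have "1 \<le> \<bar>x * inv_phi - y\<bar>" by simp
  then have "inv_phi ^ k * 1 \<le> inv_phi ^ k * \<bar>x * inv_phi - y\<bar>"
    using inv_phi_power_pos[of k] by (intro mult_left_mono) auto
  then show ?thesis using inv_phi_pos unfolding d by (simp add: abs_mult power_abs)
qed

lemma fib_Suc_bounds:
  assumes "k \<ge> 3"
  shows "fib k < fib (Suc k)" "fib (Suc k) < 2 * fib k"
proof -
  obtain i where k: "k = Suc (Suc (Suc i))"
    using assms by (metis Suc_le_D numeral_3_eq_3 Suc_le_mono)
  have "fib (Suc i) > 0" by (simp add: fib_neq_0_nat)
  then show "fib k < fib (Suc k)" "fib (Suc k) < 2 * fib k"
    by (simp_all add: k)
qed

text \<open>Non-Fibonacci lengths approximate badly: lying strictly between the two basis elements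
  forces coordinates of opposite signs that are at least as extreme as (2, -2) or (1, -3), up to a
  common sign.\<close>

lemma non_fib_approximation:
  fixes m p :: int
  assumes k: "k \<ge> 2" and m: "fib (Suc k) < m" "m < fib (Suc (Suc k))"
  shows "2 * inv_phi ^ k \<le> \<bar>m * inv_phi - p\<bar>"
proof -
  obtain x y :: int where n: "m = x * fib (Suc (Suc k)) + y * fib (Suc k)"
    and d: "m * inv_phi - p = (- inv_phi) ^ Suc k * (x * inv_phi - y)"
    using convergent_coordinates by blast
  define F G where "F = int (fib (Suc k))" and "G = int (fib (Suc (Suc k)))"
  have FG: "F > 0" "F < G" "G < 2 * F"
    using fib_Suc_bounds[of "Suc k"] k
    unfolding F_def G_def by (auto simp: fib_neq_0_nat simp del: fib.simps)
  have n': "m = x * G + y * F" using n by (simp add: F_def G_def)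
  have bd: "F < m" "m < G" using m by (auto simp: F_def G_def)
  have "(x \<ge> 2 \<and> y \<le> - 2 \<or> x \<le> - 2 \<and> y \<ge> 2) \<or> (x \<ge> 1 \<and> y \<le> - 3 \<or> x \<le> - 1 \<and> y \<ge> 3)"
  proof (rule ccontr)
    assume A: "\<not> ?thesis"
    consider "x \<ge> 2" | "x = 1" | "x = 0" | "x \<le> -1" by linarith
    then show False
    proof cases
      case 1
      then have "2 * G \<le> x * G" "- 1 * F \<le> y * F"
        using FG A by (intro mult_right_mono; simp)+
      with bd n' FG show False by linarith
    next
      case 2
      then have "y * F < 0" using n' bd by simp
      then have "y \<le> -1" using FG by (simp add: mult_less_0_iff)
      then have "y * F \<le> - 1 * F" using FG by (intro mult_right_mono; simp)
      with bd n' FG 2 show False by simp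
    next
      case 3
      then have "1 * F < y * F" using n' bd by simp
      then have "2 \<le> y" using FG by (simp only: mult_less_cancel_right) auto
      then have "2 * F \<le> y * F" using FG by (intro mult_right_mono; simp)
      with bd n' FG 3 show False by simp
    next
      case 4
      then have "x * G \<le> - 1 * G" "y * F \<le> 2 * F"
        using FG A by (intro mult_right_mono; simp)+
      with bd n' FG show False by linarith
    qed
  qed
  \<comment> \<open>The pair (1, -3) gives \<open>inv_phi + 3\<close>, which is the larger bound
    because \<open>inv_phi < 1\<close>.\<close>
  then have "2 * inv_phi + 2 \<le> \<bar>x * inv_phi - y\<bar>"
    using abs_diff_opposite_signs[of inv_phi 2 x y 2] abs_diff_opposite_signs[of inv_phi 1 x y 3]
      inv_phi_bounds by auto
  then have "inv_phi ^ Suc k * (2 * inv_phi + 2) \<le> inv_phi ^ Suc k * \<bar>x * inv_phi - y\<bar>"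
    using inv_phi_power_pos[of "Suc k"] by (intro mult_left_mono) auto
  also have "\<dots> = \<bar>m * inv_phi - p\<bar>"
    using inv_phi_pos unfolding d by (simp add: abs_mult power_abs)
  also have "inv_phi ^ Suc k * (2 * inv_phi + 2) = 2 * (inv_phi ^ Suc (Suc k) + inv_phi ^ Suc k)"
    by (simp add: algebra_simps)
  also have "\<dots> = 2 * inv_phi ^ k" by (subst inv_phi_power_Suc_Suc) simp
  finally show ?thesis .
qed

text \<open>This turns an upper bound on \<open>r * inv_phi ^ k\<close> into
  \<open>r < fib (Suc k) - 1\<close>. The inequality fails for exponent 3, so the induction starts
  at 4 and \<open>k = 3\<close> is treated apart later. The step weights the two hypotheses by
  \<open>inv_phi\<close> and its square, which sum to 1.\<close>

lemma inv_phi_power_fib_ge: "1 \<le> inv_phi ^ (k + 4) * (2 * real (fib (k + 5)) - 2)"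
proof (induction k rule: fib.induct)
  have p: "inv_phi ^ 4 = 2 - 3 * inv_phi" "inv_phi ^ 5 = 5 * inv_phi - 3"
    using inv_phi_power_Suc_Suc[of 0] inv_phi_power_Suc_Suc[of 1] inv_phi_power_Suc_Suc[of 2]
      inv_phi_power_Suc_Suc[of 3] by (simp_all add: eval_nat_numeral)
  {
    case 1
    show ?case using p inv_phi_bounds by (simp add: eval_nat_numeral)
  next
    case 2
    show ?case using p inv_phi_bounds by (simp add: eval_nat_numeral)
  }
next
  case (3 k)
  have fibs: "real (fib (Suc (Suc k) + 5)) = fib (Suc k + 5) + fib (k + 5)"
    by (simp add: eval_nat_numeral)
  have "inv_phi + inv_phi\<^sup>2 \<le> inv_phi * (inv_phi ^ (Suc k + 4) * (2 * real (fib (Suc k + 5)) - 2)) +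
      inv_phi\<^sup>2 * (inv_phi ^ (k + 4) * (2 * real (fib (k + 5)) - 2))"
    using mult_left_mono[OF 3(1), of inv_phi] mult_left_mono[OF 3(2), of "inv_phi\<^sup>2"] inv_phi_pos
    by (intro add_mono) (simp_all only: mult_1_right less_imp_le zero_le_power2)
  also have "\<dots> \<le> inv_phi ^ (Suc (Suc k) + 4) * (2 * real (fib (Suc (Suc k) + 5)) - 2)"
    unfolding fibs using inv_phi_power_pos[of "k + 6"]
    by (simp add: algebra_simps power2_eq_square numeral_eq_Suc del: fib.simps)
  finally show ?case by (simp add: inv_phi_sq)
qed

text \<open>If adding \<open>e\<close> changes the floor, the fractional part lies within
  \<open>\<bar>e\<bar>\<close> of one end of the unit interval, and the sign of \<open>e\<close>
  decides which end. So both fractional parts lie in the same short interval.\<close>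

lemma floor_jumps_close:
  fixes y z e :: real
  assumes "\<bar>e\<bar> < 1" "\<lfloor>y + e\<rfloor> \<noteq> \<lfloor>y\<rfloor>" "\<lfloor>z + e\<rfloor> \<noteq> \<lfloor>z\<rfloor>"
  shows "\<bar>y - z - of_int (\<lfloor>y\<rfloor> - \<lfloor>z\<rfloor>)\<bar> < \<bar>e\<bar>"
proof -
  have up: "\<lfloor>u\<rfloor> + 1 \<le> u + e" if "e \<ge> 0" "\<lfloor>u + e\<rfloor> \<noteq> \<lfloor>u\<rfloor>" for u
  proof (rule ccontr)
    assume "\<not> ?thesis"
    then have "\<lfloor>u + e\<rfloor> = \<lfloor>u\<rfloor>"
      using that(1) floor_correct[of u] by (intro floor_unique) linarith+
    with that(2) show False ..
  qed
  have down: "u + e < \<lfloor>u\<rfloor>" if "e < 0" "\<lfloor>u + e\<rfloor> \<noteq> \<lfloor>u\<rfloor>" for u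
  proof (rule ccontr)
    assume "\<not> ?thesis"
    then have "\<lfloor>u + e\<rfloor> = \<lfloor>u\<rfloor>"
      using that(1) floor_correct[of u] by (intro floor_unique) linarith+
    with that(2) show False ..
  qed
  show ?thesis
  proof (cases "e \<ge> 0")
    case True
    then show ?thesis
      using up[OF True assms(2)] up[OF True assms(3)] floor_correct[of y] floor_correct[of z]
      by (simp only: of_int_diff) linarith
  next
    case False
    then have "e < 0" by simp
    then show ?thesis
      using down[OF \<open>e < 0\<close> assms(2)] down[OF \<open>e < 0\<close> assms(3)] floor_correct[of y] floor_correct[of z]
      by (simp only: of_int_diff) linarith
  qed
qed

section \<open>Counting letters in the Fibonacci word\<close>

text \<open>The shift to \<open>Suc n\<close> reflects that the initial point of this Sturmian word
  equals its angle. That this counts letters is \<open>count_A_prefix\<close>.\<close>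

definition prefix_As :: "nat \<Rightarrow> int" where
  "prefix_As n = \<lfloor>real (Suc n) * inv_phi\<rfloor>"

lemma inv_phi_multiple_not_int:
  assumes "n > 0"
  shows "real n * inv_phi \<noteq> of_int p"
proof
  assume *: "real n * inv_phi = of_int p"
  have "\<exists>k. n < fib (Suc k)"
    using length_fib_word fib_word_longer[of n] by metis
  then obtain k where "n < fib (Suc k)" ..
  then have "inv_phi ^ k \<le> \<bar>int n * inv_phi - p\<bar>"
    using assms by (intro fib_best_approximation) auto
  then show False using * inv_phi_power_pos[of k] by simp
qed

text \<open>Adding \<open>fib (Suc k)\<close> moves the argument of the floor by
  \<open>fib k\<close> plus a tiny error, and best approximation keeps the old argument at least
  that error away from every integer. This mirrors the recursion of \<open>fib_word\<close>.\<close>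

lemma prefix_As_fib_add:
  assumes "Suc n < fib (Suc (Suc k))"
  shows "prefix_As (fib (Suc k) + n) = fib k + prefix_As n"
proof -
  define e where "e = (-1) ^ k * inv_phi ^ Suc k"
  define y where "y = real (Suc n) * inv_phi"
  have F: "fib (Suc k) * inv_phi = fib k + e"
    using fib_mult_inv_phi[of k] by (simp add: e_def)
  have "\<bar>e\<bar> = inv_phi ^ Suc k" using inv_phi_pos by (simp add: e_def abs_mult power_abs)
  then have far: "\<bar>e\<bar> \<le> \<bar>y - of_int p\<bar>" for p :: int
    using fib_best_approximation[of "int (Suc n)" "Suc k" p] assms by (simp add: y_def)
  \<comment> \<open>Best approximation leaves open that \<open>y + e\<close> is exactly the next
    integer; irrationality excludes it.\<close>
  have "y \<noteq> of_int \<lfloor>y\<rfloor>" "y + e \<noteq> of_int (\<lfloor>y\<rfloor> + 1)"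
  proof -
    show "y \<noteq> of_int \<lfloor>y\<rfloor>" unfolding y_def by (rule inv_phi_multiple_not_int) simp
    show "y + e \<noteq> of_int (\<lfloor>y\<rfloor> + 1)"
      using inv_phi_multiple_not_int[of "fib (Suc k) + Suc n" "\<lfloor>y\<rfloor> + 1 + fib k"] F
      by (auto simp: y_def algebra_simps)
  qed
  then have "\<lfloor>y + e\<rfloor> = \<lfloor>y\<rfloor>"
    using far[of "\<lfloor>y\<rfloor>"] far[of "\<lfloor>y\<rfloor> + 1"] floor_correct[of y]
    by (intro floor_unique) auto
  moreover have "real (Suc (fib (Suc k) + n)) * inv_phi = of_int (fib k) + (y + e)"
    using F by (simp add: y_def algebra_simps)
  ultimately show ?thesis
    unfolding prefix_As_def y_def[symmetric] by simp
qed

lemma count_A_fib_word: "count_list (fib_word k) A = fib k"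
  by (induction k rule: fib_word.induct) auto

lemma count_A_take_fib_word:
  "n \<le> fib (Suc (Suc k)) \<Longrightarrow> int (count_list (take n (fib_word (Suc k))) A) = prefix_As n"
proof (induction k arbitrary: n rule: fib.induct)
  have fl: "\<lfloor>inv_phi\<rfloor> = 0" "\<lfloor>2 * inv_phi\<rfloor> = 1" "\<lfloor>3 * inv_phi\<rfloor> = 1"
    using inv_phi_bounds by (auto intro!: floor_unique)
  {
    case 1
    then have "n = 0 \<or> n = 1" by auto
    then show ?case using fl by (auto simp: prefix_As_def)
  next
    case 2
    then have "n = 0 \<or> n = 1 \<or> n = 2" by auto
    then show ?case using fl by (auto simp: prefix_As_def)
  }
next
  case (3 k)
  let ?G = "fib (Suc (Suc (Suc k)))"
  have fib_word_eq: "fib_word (Suc (Suc (Suc k))) = fib_word (Suc (Suc k)) @ fib_word (Suc k)"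
    by (rule fib_word.simps(3))
  have len: "length (fib_word (Suc (Suc k))) = ?G" by (rule length_fib_word)
  show ?case
  proof (cases "n \<le> ?G")
    case True
    then show ?thesis using 3(1)[of n] len by (simp add: fib_word_eq del: fib_word.simps fib.simps)
  next
    case False
    then obtain i where n: "n = ?G + i" by (metis le_add_diff_inverse nat_le_linear)
    have i: "i \<le> fib (Suc (Suc k))"
      using 3(3) unfolding n by simp
    have "fib (Suc k) > 0" by (simp add: fib_neq_0_nat)
    then have "Suc i < fib (Suc (Suc (Suc (Suc k))))" using i fib_mono[of 1 "Suc (Suc k)"]
      by (simp add: add_strict_increasing)
    then have "prefix_As n = fib (Suc (Suc k)) + prefix_As i"
      unfolding n by (rule prefix_As_fib_add)
    moreover have "take n (fib_word (Suc (Suc (Suc k)))) = fib_word (Suc (Suc k)) @ take i (fib_word (Suc k))"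
      by (simp add: fib_word_eq len n del: fib_word.simps fib.simps)
    ultimately show ?thesis
      using 3(2)[OF i] count_A_fib_word[of "Suc (Suc k)"] by (simp del: fib_word.simps fib.simps)
  qed
qed

lemma count_A_prefix: "int (count_list (inf_fib_word [0 \<rightarrow> n]) A) = prefix_As n"
proof -
  have "\<forall>\<^sub>F m in sequentially. \<forall>i\<in>{..<n}. i < length (fib_word m) \<and> fib_word m ! i = inf_fib_word i"
    using inf_fib_word_limit unfolding words_converge_def
    by (intro eventually_ball_finite) auto
  then obtain m where m: "\<forall>l\<ge>m. \<forall>i<n. i < length (fib_word l) \<and> fib_word l ! i = inf_fib_word i"
    unfolding eventually_sequentially by auto
  define l where "l = Suc (m + Suc n)"
  have len: "n \<le> length (fib_word l)"
    using m[rule_format, of l "n - 1"] by (cases n) (auto simp: l_def simp del: fib_word.simps)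
  have "inf_fib_word [0 \<rightarrow> n] = take n (fib_word l)"
    using m[rule_format, of l] len
    by (intro nth_equalityI) (auto simp: l_def simp del: fib_word.simps)
  moreover have "n \<le> fib (Suc (Suc (m + Suc n)))"
    using len unfolding l_def length_fib_word .
  ultimately show ?thesis
    using count_A_take_fib_word[of n "m + Suc n"] by (simp add: l_def del: fib_word.simps)
qed

lemma subsequence_append_adjacent:
  "i \<le> j \<Longrightarrow> j \<le> k \<Longrightarrow> x [i \<rightarrow> j] @ x [j \<rightarrow> k] = x [i \<rightarrow> k]"
  unfolding subsequence_def by (metis map_append upt_add_eq_append le_add_diff_inverse)

lemma count_A_subsequence:
  assumes "i \<le> j"
  shows "int (count_list (inf_fib_word [i \<rightarrow> j]) A) = prefix_As j - prefix_As i"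
proof -
  have "inf_fib_word [0 \<rightarrow> j] = inf_fib_word [0 \<rightarrow> i] @ inf_fib_word [i \<rightarrow> j]"
    using assms by (simp add: subsequence_append_adjacent)
  then show ?thesis
    using count_A_prefix[of i] count_A_prefix[of j] by simp
qed

lemma count_A_plus_count_B: "count_list w A + count_list w B = length w"
  using parikh_norm_parikh[of w] by (simp add: parikh_norm_def parikh_def)

section \<open>Abelian periods of factors\<close>

lemma concat_adjacent_subsequences:
  assumes "\<And>q. q < n \<Longrightarrow> e q \<le> e (Suc q)"
  shows "concat (map (\<lambda>q. x [e q \<rightarrow> e (Suc q)]) [0..<n]) = x [e 0 \<rightarrow> e n]"
proof -
  have "e 0 \<le> e n \<and> concat (map (\<lambda>q. x [e q \<rightarrow> e (Suc q)]) [0..<n]) = x [e 0 \<rightarrow> e n]"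
    using assms
  proof (induction n)
    case (Suc n)
    then have IH: "e 0 \<le> e n" and eq: "concat (map (\<lambda>q. x [e q \<rightarrow> e (Suc q)]) [0..<n]) = x [e 0 \<rightarrow> e n]"
      and le: "e n \<le> e (Suc n)" by auto
    have "concat (map (\<lambda>q. x [e q \<rightarrow> e (Suc q)]) [0..<Suc n]) = x [e 0 \<rightarrow> e n] @ x [e n \<rightarrow> e (Suc n)]"
      by (simp add: eq)
    with IH le show ?case by (simp add: subsequence_append_adjacent)
  qed simp
  then show ?thesis ..
qed

lemma abelian_period_subsequenceI:
  assumes "r \<ge> 1" "t + r * m \<le> L" "parikh_norm P = m"
    and blocks: "\<And>q. q < r \<Longrightarrow> parikh (x [i + t + q * m \<rightarrow> i + t + q * m + m]) = P"
    and head: "parikh_contained (parikh (x [i \<rightarrow> i + t])) P"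
    and tail: "parikh_contained (parikh (x [i + t + r * m \<rightarrow> i + L])) P"
  shows "abelian_period m (x [i \<rightarrow> i + L])"
proof -
  \<comment> \<open>Cut points of the factorization: head of length \<open>t\<close>, then
    \<open>r\<close> blocks of length \<open>m\<close>, then the tail ending at
    \<open>i + L\<close>.\<close>
  define e where "e q = (if q = 0 then i else if q \<le> Suc r then i + t + (q - 1) * m else i + L)" for q
  define u where "u q = (x [e q \<rightarrow> e (Suc q)])" for q
  have "e q \<le> e (Suc q)" if "q < Suc (Suc r)" for q
  proof -
    consider "q = 0" | p where "q = Suc p" "p < r" | "q = Suc r"
      using \<open>q < Suc (Suc r)\<close> by (cases q) force+
    then show ?thesis using assms(2) by cases (auto simp: e_def)
  qed
  from concat_adjacent_subsequences[of "Suc (Suc r)" e x, OF this]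
  have "x [i \<rightarrow> i + L] = concat (map u [0..<Suc (Suc r)])"
    unfolding u_def by (simp add: e_def)
  moreover have "parikh (u q) = P" if "q \<in> {1..Suc r - 1}" for q
  proof -
    obtain p where "q = Suc p" "p < r" using \<open>q \<in> {1..Suc r - 1}\<close> by (cases q) auto
    then show ?thesis using blocks[of p] by (simp add: u_def e_def ac_simps)
  qed
  moreover have "parikh_contained (parikh (u 0)) P" "parikh_contained (parikh (u (Suc r))) P"
    using head tail by (simp_all add: u_def e_def)
  ultimately show ?thesis
    unfolding abelian_period_def using assms(1,3)
    by (intro exI[of _ "Suc r"] exI[of _ u] exI[of _ P] conjI ballI) auto
qed

lemma concat_equal_parikh:
  assumes "\<And>q. q \<in> set qs \<Longrightarrow> parikh (u q) = P"
  shows "length (concat (map u qs)) = length qs * parikh_norm P \<and>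
    count_list (concat (map u qs)) A = length qs * fst P"
  using assms
proof (induction qs)
  case (Cons q qs)
  have "parikh (u q) = P" by (simp add: Cons.prems)
  then have "length (u q) = parikh_norm P" "count_list (u q) A = fst P"
    using parikh_norm_parikh[of "u q"] by (auto simp: parikh_def)
  then show ?case using Cons by simp
qed simp

lemma abelian_periodE:
  assumes "abelian_period m w"
  obtains u v z r c where "w = u @ v @ z" "length u < m" "length z < m" "r \<ge> 1"
    "length v = r * m" "count_list v A = r * c"
proof -
  obtain j and u :: "nat \<Rightarrow> letter list" and P where *: "j \<ge> 2" "w = concat (map u [0..<Suc j])"
    "parikh_norm P = m" "\<And>i. i \<in> {1..j - 1} \<Longrightarrow> parikh (u i) = P"
    "parikh_contained (parikh (u 0)) P" "parikh_contained (parikh (u j)) P"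
    using assms unfolding abelian_period_def by blast
  have "[0..<Suc j] = 0 # [1..<j] @ [j]"
    using *(1) by (simp add: upt_conv_Cons)
  then have "w = u 0 @ concat (map u [1..<j]) @ u j" using *(2) by simp
  moreover have "length (u 0) < m" "length (u j) < m"
    using *(3,5,6) by (auto simp: parikh_contained_def parikh_norm_parikh)
  moreover have "j - 1 \<ge> 1" using *(1) by simp
  moreover have "\<And>q. q \<in> set [1..<j] \<Longrightarrow> parikh (u q) = P" using *(4) by auto
  then have "length (concat (map u [1..<j])) = (j - 1) * m"
    "count_list (concat (map u [1..<j])) A = (j - 1) * fst P"
    using concat_equal_parikh[of "[1..<j]" u P] *(3) by auto
  ultimately show thesis by (rule that)
qed

text \<open>The \<open>r\<close> equal blocks together contain \<open>r * c\<close> letters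
  \<open>A\<close>, while any factor of length n contains n * \<open>inv_phi\<close> of them up to
  an error below 1. The upper bound on \<open>L\<close> holds because head and tail each have length
  at most \<open>m - 1\<close>.\<close>

lemma abelian_period_inf_fib_word:
  assumes "abelian_period m (inf_fib_word [i \<rightarrow> i + L])"
  obtains r :: nat and p :: int where "r \<ge> 1" "r * m \<le> L" "L + 2 \<le> (r + 2) * m"
    "r * \<bar>m * inv_phi - p\<bar> < 1"
proof -
  from abelian_periodE[OF assms] obtain u v z r c where w: "inf_fib_word [i \<rightarrow> i + L] = u @ v @ z"
    and len: "length u < m" "length z < m" "r \<ge> 1" "length v = r * m"
    and c: "count_list v A = r * c" by blast
  have L: "L = length u + r * m + length z"
    using arg_cong[OF w, of length] len by simp
  define b where "b = i + length u"
  have "v = take (r * m) (drop (length u) (inf_fib_word [i \<rightarrow> i + L]))"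
    using len(4) by (simp add: w)
  also have "\<dots> = inf_fib_word [b \<rightarrow> b + r * m]"
    using L by (simp add: b_def)
  finally have "prefix_As (b + r * m) - prefix_As b = int (r * c)"
    using count_A_subsequence[of b "b + r * m"] c by simp
  moreover have "real (Suc (b + r * m)) * inv_phi = real (Suc b) * inv_phi + r * (m * inv_phi)"
    by (simp add: algebra_simps)
  ultimately have "\<lfloor>real (Suc b) * inv_phi + r * (m * inv_phi)\<rfloor> = \<lfloor>real (Suc b) * inv_phi\<rfloor> + int (r * c)"
    by (simp only: prefix_As_def)
  then have "\<bar>r * (m * inv_phi) - int (r * c)\<bar> < 1" by linarith
  moreover have "r * (m * inv_phi) - int (r * c) = r * (m * inv_phi - int c)"
    by (simp add: algebra_simps)
  ultimately have "r * \<bar>m * inv_phi - int c\<bar> < 1" by (simp add: abs_mult)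
  moreover have "r * m \<le> L" "L + 2 \<le> (r + 2) * m" using L len by auto
  ultimately show thesis using len(3) that by blast
qed

section \<open>Exceptional positions: starts of blocks of Fibonacci length with an unusual number of
  letters \<open>A\<close>\<close>

lemma exceptional_positions_approximation:
  assumes "prefix_As (n + fib (Suc k)) \<noteq> prefix_As n + fib k"
    and "prefix_As (n' + fib (Suc k)) \<noteq> prefix_As n' + fib k"
  obtains p where "\<bar>(int n' - int n) * inv_phi - of_int p\<bar> < inv_phi ^ Suc k"
proof -
  define e where "e = (-1) ^ k * inv_phi ^ Suc k"
  define y where "y j = real (Suc j) * inv_phi" for j
  have abs_e: "\<bar>e\<bar> = inv_phi ^ Suc k" using inv_phi_pos by (simp add: e_def abs_mult power_abs)
  have "inv_phi ^ Suc k < 1"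
    using inv_phi_pos inv_phi_less_1 by (intro power_Suc_less_one)
  then have small: "\<bar>e\<bar> < 1" using abs_e by simp
  have "real (Suc (j + fib (Suc k))) * inv_phi = of_int (fib k) + (y j + e)" for j
    using fib_mult_inv_phi[of k] by (simp add: y_def e_def algebra_simps)
  \<comment> \<open>So a position is exceptional precisely when adding \<open>e\<close> changes the
    floor.\<close>
  then have shift: "prefix_As (j + fib (Suc k)) = fib k + \<lfloor>y j + e\<rfloor>" for j
    unfolding prefix_As_def by simp
  have "prefix_As j = \<lfloor>y j\<rfloor>" for j by (simp add: prefix_As_def y_def)
  then have "\<lfloor>y n' + e\<rfloor> \<noteq> \<lfloor>y n'\<rfloor>" "\<lfloor>y n + e\<rfloor> \<noteq> \<lfloor>y n\<rfloor>"
    using assms shift by auto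
  from floor_jumps_close[OF small this]
  have "\<bar>y n' - y n - of_int (\<lfloor>y n'\<rfloor> - \<lfloor>y n\<rfloor>)\<bar> < inv_phi ^ Suc k" using abs_e by simp
  moreover have "y n' - y n = (int n' - int n) * inv_phi"
    by (simp add: y_def algebra_simps)
  ultimately show thesis using that by metis
qed

text \<open>A smaller difference would contradict best approximation one index higher.\<close>

lemma exceptional_positions_gap:
  assumes "prefix_As (n + fib (Suc k)) \<noteq> prefix_As n + fib k"
    and "prefix_As (n' + fib (Suc k)) \<noteq> prefix_As n' + fib k" and "n < n'"
  shows "n + fib (Suc (Suc k)) \<le> n'"
proof (rule ccontr)
  obtain p where p: "\<bar>(int n' - int n) * inv_phi - of_int p\<bar> < inv_phi ^ Suc k"
    using exceptional_positions_approximation[OF assms(1,2)] .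
  assume "\<not> ?thesis"
  then have "inv_phi ^ Suc k \<le> \<bar>(int n' - int n) * inv_phi - of_int p\<bar>"
    using assms(3) by (intro fib_best_approximation) (auto simp del: fib.simps)
  with p show False by simp
qed

lemma exceptional_positions_gap_3:
  assumes "prefix_As (n + 3) \<noteq> prefix_As n + 2"
    and "prefix_As (n' + 3) \<noteq> prefix_As n' + 2" and "n < n'" "n' \<le> n + 11"
  shows "n' = n + 5 \<or> n' = n + 8"
proof -
  have fibs: "fib (Suc 3) = 3" "fib 3 = 2" "fib (Suc (Suc 3)) = 5"
    by (simp_all add: eval_nat_numeral)
  obtain p where p: "\<bar>(int n' - int n) * inv_phi - of_int p\<bar> < inv_phi ^ Suc 3"
    using exceptional_positions_approximation[of n 3 n'] assms(1,2) unfolding fibs by auto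
  have "inv_phi ^ Suc 3 = 2 - 3 * inv_phi"
    using inv_phi_power_Suc_Suc[of 0] inv_phi_power_Suc_Suc[of 1] inv_phi_power_Suc_Suc[of 2]
    by (simp add: eval_nat_numeral)
  then have less: "inv_phi ^ Suc 3 < 2/13" using inv_phi_bounds by simp
  \<comment> \<open>The conditions place \<open>real d * inv_phi\<close> between
    \<open>c - 1\<close> and \<open>c\<close>, more than 2/13 away from both.\<close>
  have far: False if "n' = n + d" "real d * inv_phi < of_int c - 2/13" "of_int c - 11/13 < real d * inv_phi" for d and c :: int
  proof -
    have "\<bar>real d * inv_phi - of_int p\<bar> < 2/13" using p less that(1) by simp
    with that(2,3) have "real_of_int p < of_int c" "real_of_int (c - 1) < of_int p"
      by (simp only: of_int_diff of_int_1, linarith)+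
    then show False by (simp only: of_int_less_iff)
  qed
  have "n + 5 \<le> n'"
    using exceptional_positions_gap[of n 3 n'] assms unfolding fibs by simp
  then have "n' = n + 5 \<or> n' = n + 6 \<or> n' = n + 7 \<or> n' = n + 8 \<or> n' = n + 9 \<or> n' = n + 10 \<or> n' = n + 11"
    using assms(4) by linarith
  moreover have "n' \<noteq> n + 6" using far[of 6 4] inv_phi_bounds by auto
  moreover have "n' \<noteq> n + 7" using far[of 7 5] inv_phi_bounds by auto
  moreover have "n' \<noteq> n + 9" using far[of 9 6] inv_phi_bounds by auto
  moreover have "n' \<noteq> n + 10" using far[of 10 7] inv_phi_bounds by auto
  moreover have "n' \<noteq> n + 11" using far[of 11 7] inv_phi_bounds by auto
  ultimately show ?thesis by blast
qed

text \<open>Division by \<open>G\<close> is injective on a set with gaps at least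
  \<open>G\<close>.\<close>

lemma card_separated_le:
  fixes S :: "nat set"
  assumes "S \<subseteq> {..s}" "G > 0" "\<And>a b. a \<in> S \<Longrightarrow> b \<in> S \<Longrightarrow> a < b \<Longrightarrow> a + G \<le> b"
  shows "card S \<le> Suc (s div G)"
proof -
  have less: "a div G < b div G" if "a \<in> S" "b \<in> S" "a < b" for a b
    using div_le_mono[OF assms(3)[OF that], of G] assms(2) by simp
  have "inj_on (\<lambda>a. a div G) S"
    by (rule inj_onI) (metis less less_irrefl linorder_neqE_nat)
  then have "card S = card ((\<lambda>a. a div G) ` S)" by (simp add: card_image)
  also have "\<dots> \<le> card {..s div G}"
    using assms(1) by (intro card_mono) (auto intro: div_le_mono)
  finally show ?thesis by simp
qed

text \<open>Heads and tails thus impose no condition beyond their length. Letter counts deviate from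
  \<open>t * inv_phi\<close> by less than 1; with \<open>t + 1\<close> at most the block length, the
  counts of \<open>A\<close> and \<open>B\<close> exceed those of a regular block by less than 1,
  hence not at all.\<close>

lemma parikh_contained_short_factor:
  assumes "k \<ge> 2" "t < fib (Suc k)"
  shows "parikh_contained (parikh (inf_fib_word [n \<rightarrow> n + t])) (fib k, fib (Suc k) - fib k)"
proof -
  let ?v = "inf_fib_word [n \<rightarrow> n + t]"
  let ?c = "real (count_list ?v A)"
  have "int (count_list ?v A) = \<lfloor>real (Suc (n + t)) * inv_phi\<rfloor> - \<lfloor>real (Suc n) * inv_phi\<rfloor>"
    using count_A_subsequence[of n "n + t"] by (simp add: prefix_As_def)
  moreover have "real (Suc (n + t)) * inv_phi = real (Suc n) * inv_phi + t * inv_phi"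
    by (simp add: algebra_simps)
  ultimately have c: "?c < t * inv_phi + 1" "t * inv_phi - 1 < ?c" by linarith+
  have t: "real t + 1 \<le> fib (Suc k)" using assms(2) by linarith
  have e: "\<bar>fib (Suc k) * inv_phi - fib k\<bar> = inv_phi ^ Suc k"
    using inv_phi_pos unfolding fib_mult_inv_phi by (simp add: abs_mult power_abs)
  have "inv_phi ^ Suc k \<le> inv_phi ^ 3"
    using assms(1) inv_phi_pos inv_phi_less_1 by (intro power_decreasing) auto
  also have "inv_phi ^ 3 = inv_phi - (1 - inv_phi)"
    using inv_phi_power_Suc_Suc[of 1] inv_phi_sq by (simp add: eval_nat_numeral)
  finally have e3: "inv_phi ^ Suc k \<le> 2 * inv_phi - 1" by simp
  have "(real t + 1) * inv_phi \<le> fib (Suc k) * inv_phi"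
    using t inv_phi_pos by (intro mult_right_mono) auto
  then have "?c < fib k + 1"
    using c(1) e e3 inv_phi_bounds by (simp add: algebra_simps; linarith)
  then have A: "count_list ?v A \<le> fib k" by linarith
  have "(real t + 1) * (1 - inv_phi) \<le> fib (Suc k) * (1 - inv_phi)"
    using t inv_phi_less_1 by (intro mult_right_mono) auto
  then have "real t - ?c < real (fib (Suc k)) - real (fib k) + 1"
    using c(2) e e3 inv_phi_bounds by (simp add: algebra_simps; linarith)
  then have "t + fib k \<le> fib (Suc k) + count_list ?v A" by linarith
  moreover have "count_list ?v A + count_list ?v B = t"
    by (simp add: count_A_plus_count_B)
  ultimately have B: "count_list ?v B \<le> fib (Suc k) - fib k" by linarith
  show ?thesis
    unfolding parikh_contained_def parikh_norm_parikh
    using A B assms(2) fib_Suc_mono[of k] by (simp add: parikh_def parikh_norm_def)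
qed

text \<open>Exceptional positions are too far apart to meet all residue classes modulo \<open>fib (Suc k)\<close>.
  For \<open>k = 3\<close> the gap bound alone does not suffice: two consecutive gaps of length 5 have to be
  excluded.\<close>

lemma regular_offset:
  assumes k: "k \<ge> 3" and L: "fib (Suc k) < L"
    and bound: "L + fib (Suc (Suc k)) < fib (Suc k) * fib (Suc (Suc k)) + fib (Suc k) \<or> k = 3 \<and> L \<le> 14"
  obtains t where "t < fib (Suc k)" "t + fib (Suc k) \<le> L"
    "\<And>q. t + q * fib (Suc k) + fib (Suc k) \<le> L \<Longrightarrow>
      prefix_As (i + (t + q * fib (Suc k)) + fib (Suc k)) = prefix_As (i + (t + q * fib (Suc k))) + fib k"
proof (rule ccontr)
  note offset = that
  assume no_offset: "\<not> thesis"
  define F G where "F = fib (Suc k)" and "G = fib (Suc (Suc k))"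
  define E where "E n \<longleftrightarrow> prefix_As (n + F) \<noteq> prefix_As n + fib k" for n
  have FG: "F > 0" "F < G"
    using fib_Suc_bounds[of "Suc k"] k unfolding F_def G_def by (auto simp: fib_neq_0_nat simp del: fib.simps)
  \<comment> \<open>Each admissible offset \<open>t\<close> meets an exceptional position congruent
    to \<open>t\<close> modulo \<open>F\<close>. These positions are distinct, and there are
    \<open>T\<close> of them.\<close>
  have "\<exists>q. t + q * F + F \<le> L \<and> E (i + (t + q * F))" if "t < F" "t + F \<le> L" for t
    using no_offset offset[of t] that unfolding E_def F_def by blast
  then obtain f where f: "\<And>t. t < F \<Longrightarrow> t + F \<le> L \<Longrightarrow> t + f t * F + F \<le> L \<and> E (i + (t + f t * F))"
    by metis
  define h where "h t = t + f t * F" for t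
  define T where "T = min F (L - F + 1)"
  have h: "h t \<le> L - F" "E (i + h t)" "h t mod F = t" if "t < T" for t
  proof -
    have "t < F" "t + F \<le> L" using that L by (auto simp: T_def F_def)
    from this f[OF this] show "h t \<le> L - F" "E (i + h t)" "h t mod F = t"
      unfolding h_def by (linarith, simp_all)
  qed
  have gap: "a + G \<le> b" if "E (i + a)" "E (i + b)" "a < b" for a b
    using exceptional_positions_gap[of "i + a" k "i + b"] that unfolding E_def F_def G_def by simp
  have "inj_on h {..<T}" by (rule inj_onI) (metis h(3) lessThan_iff)
  then have "T = card (h ` {..<T})" by (simp add: card_image)
  also have "\<dots> \<le> Suc ((L - F) div G)"
    using h FG by (intro card_separated_le) (auto intro!: gap)
  finally have T: "T \<le> Suc ((L - F) div G)" .
  have "F \<le> L - F + 1"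
  proof (rule ccontr)
    assume "\<not> ?thesis"
    then have "L - F \<le> (L - F) div G" using T by (simp add: T_def)
    moreover have "(L - F) div G < L - F"
      using FG L by (intro div_less_dividend) (auto simp: F_def)
    ultimately show False by simp
  qed
  then have TF: "T = F" by (simp add: T_def)
  then have "F - 1 \<le> (L - F) div G" using T by simp
  \<comment> \<open>\<open>F\<close> positions with gaps at least \<open>G\<close> span at least
    \<open>(F - 1) * G\<close>, which refutes the first alternative of \<open>bound\<close>.\<close>
  then have "(F - 1) * G \<le> L - F"
    using FG by (simp add: less_eq_div_iff_mult_less_eq)
  then have "F * G + F \<le> L + G"
    using L FG by (simp add: diff_mult_distrib F_def[symmetric])
  then have k3: "k = 3" "L \<le> 14" using bound by (simp_all add: F_def G_def)
  then have F3: "F = 3" "fib k = 2" by (simp_all add: F_def eval_nat_numeral)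
  have gap3: "b = a + 5 \<or> b = a + 8" if "E (i + a)" "E (i + b)" "a < b" "b \<le> 11" for a b
    using exceptional_positions_gap_3[of "i + a" "i + b"] that unfolding E_def F3 by simp
  have pair: "h b = h a + 5 \<or> h b = h a + 8 \<or> h a = h b + 5 \<or> h a = h b + 8"
    if "a < 3" "b < 3" "a \<noteq> b" for a b
  proof -
    have "h a \<le> 11" "h b \<le> 11" "h a \<noteq> h b"
      using h(1)[of a] h(1)[of b] h(3)[of a] h(3)[of b] that TF F3 k3 by auto
    then show ?thesis using gap3[of "h a" "h b"] gap3[of "h b" "h a"] h(2)[of a] h(2)[of b] that TF F3
      by (meson linorder_neqE_nat)
  qed
  \<comment> \<open>Of three positions, the largest difference is the sum of the other two, but
    neither 5 nor 8 is a sum of two numbers from {5, 8}.\<close>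
  show False using pair[of 0 1] pair[of 1 2] pair[of 0 2] by simp linarith
qed

lemma abelian_period_fib:
  assumes k: "k \<ge> 3" and L: "fib (Suc k) < L"
    and bound: "L + fib (Suc (Suc k)) < fib (Suc k) * fib (Suc (Suc k)) + fib (Suc k) \<or> k = 3 \<and> L \<le> 14"
  shows "abelian_period (fib (Suc k)) (inf_fib_word [i \<rightarrow> i + L])"
proof -
  define F where "F = fib (Suc k)"
  from regular_offset[OF assms, of i] obtain t where t: "t < F" "t + F \<le> L"
    and regular: "\<And>q. t + q * F + F \<le> L \<Longrightarrow> prefix_As (i + (t + q * F) + F) = prefix_As (i + (t + q * F)) + fib k"
    unfolding F_def by blast
  define r where "r = (L - t) div F"
  have "F > 0" using t by simp
  have r: "r * F \<le> L - t" "L - t < r * F + F"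
    using \<open>F > 0\<close> using dividend_less_div_times[of F "L - t"] by (simp_all add: r_def add.commute)
  show ?thesis
    unfolding F_def[symmetric]
  proof (rule abelian_period_subsequenceI)
    show "1 \<le> r" using t \<open>F > 0\<close> by (simp add: r_def less_eq_div_iff_mult_less_eq)
    show "t + r * F \<le> L" using r t by simp
    show "parikh_norm (fib k, F - fib k) = F"
      using fib_Suc_mono[of k] by (simp add: parikh_norm_def F_def)
    show "parikh_contained (parikh (inf_fib_word [i \<rightarrow> i + t])) (fib k, F - fib k)"
      using parikh_contained_short_factor[of k t i] k t(1) by (simp add: F_def)
    have "i + L = i + t + r * F + (L - t - r * F)" using r t by simp
    moreover have "L - t - r * F < F" using r by simp
    ultimately show "parikh_contained (parikh (inf_fib_word [i + t + r * F \<rightarrow> i + L])) (fib k, F - fib k)"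
      using parikh_contained_short_factor[of k "L - t - r * F" "i + t + r * F"] k
      unfolding F_def by (simp del: fib.simps)
  next
    fix q assume "q < r"
    then have "Suc q * F \<le> r * F" by (intro mult_le_mono1) simp
    then have "t + q * F + F \<le> L" using r t by simp
    let ?v = "inf_fib_word [i + t + q * F \<rightarrow> i + t + q * F + F]"
    have "int (count_list ?v A) = fib k"
      using regular[OF \<open>t + q * F + F \<le> L\<close>] by (simp add: count_A_subsequence add.assoc)
    moreover have "count_list ?v A + count_list ?v B = F"
      by (simp add: count_A_plus_count_B)
    ultimately show "parikh ?v = (fib k, F - fib k)" by (simp add: parikh_def)
  qed
qed

section \<open>Periods strictly between consecutive Fibonacci numbers\<close>

lemma between_fibs:
  assumes "m \<ge> 1" "\<nexists>j. m = fib (Suc j)"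
  obtains k where "k \<ge> 3" "fib (Suc k) < m" "m < fib (Suc (Suc k))"
proof -
  have ex: "\<exists>k. m < fib (Suc (Suc k))"
    using length_fib_word fib_word_longer[of m] by metis
  define k where "k = (LEAST k. m < fib (Suc (Suc k)))"
  have less: "m < fib (Suc (Suc k))" unfolding k_def by (rule LeastI_ex[OF ex])
  have "k \<noteq> 0" using less assms(1) by (intro notI) simp
  then obtain l where l: "k = Suc l" by (cases k) auto
  have "\<not> m < fib (Suc (Suc l))"
    using not_less_Least[of l "\<lambda>k. m < fib (Suc (Suc k))"] by (simp add: k_def[symmetric] l del: fib.simps)
  then have ge: "fib (Suc k) < m" using assms(2) l by (metis linorder_neqE_nat)
  \<comment> \<open>No integer lies strictly between 1 and 2 or between 2 and 3.\<close>
  have "k \<noteq> 1" "k \<noteq> 2" using less ge by (auto simp: eval_nat_numeral)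
  with \<open>k \<noteq> 0\<close> have "k \<ge> 3" by simp
  with ge less show thesis by (rule that[rotated 1])
qed

text \<open>Bad approximation by \<open>m\<close> bounds the number \<open>r\<close> of its blocks,
  hence \<open>L\<close>, and this is short enough for \<open>abelian_period_fib\<close>.\<close>

lemma abelian_period_not_fib:
  assumes "abelian_period m (inf_fib_word [i \<rightarrow> i + L])"
    and k: "k \<ge> 3" and m: "fib (Suc k) < m" "m < fib (Suc (Suc k))"
  shows "abelian_period (fib (Suc k)) (inf_fib_word [i \<rightarrow> i + L])"
proof -
  define F G where "F = fib (Suc k)" and "G = fib (Suc (Suc k))"
  obtain r :: nat and p :: int where r: "r \<ge> 1" "r * m \<le> L" "L + 2 \<le> (r + 2) * m"
    "r * \<bar>m * inv_phi - p\<bar> < 1"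
    using abelian_period_inf_fib_word[OF assms(1)] .
  have "2 * inv_phi ^ k \<le> \<bar>int m * inv_phi - p\<bar>"
    using k m by (intro non_fib_approximation) auto
  then have "r * (2 * inv_phi ^ k) \<le> r * \<bar>m * inv_phi - p\<bar>"
    by (intro mult_left_mono) auto
  with r(4) have r_less: "inv_phi ^ k * (2 * r) < 1" by (simp add: mult_ac)
  have "1 * m \<le> r * m" using r(1) by (intro mult_le_mono1)
  then have "F < L" using m(1) r(2) unfolding F_def by linarith
  moreover have "L + G < F * G + F \<or> k = 3 \<and> L \<le> 14"
  proof (cases "k = 3")
    case True
    then have "m = 4" using m by (simp add: eval_nat_numeral)
    have "inv_phi ^ 3 = 2 * inv_phi - 1"
      using inv_phi_power_Suc_Suc[of 1] inv_phi_sq by (simp add: eval_nat_numeral)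
    then have "3/13 < inv_phi ^ 3" using inv_phi_bounds by simp
    then have "3/13 * real (2 * r) \<le> inv_phi ^ k * (2 * r)"
      unfolding True by (intro mult_right_mono) auto
    then have "3/13 * real (2 * r) < 1" using r_less by linarith
    then have "r \<le> 2" by simp
    \<comment> \<open>Two blocks of length 4 allow \<open>L\<close> up to 14, whereas the general
      inequality for \<open>k = 3\<close> reaches only 12; hence the extra alternative.\<close>
    then show ?thesis using r(3) \<open>m = 4\<close> True by simp
  next
    case False
    with k have "4 \<le> k" by simp
    then obtain l where l: "k = l + 4" by (metis le_Suc_ex add.commute)
    then have Suc_k: "Suc k = l + 5" by simp
    have "1 \<le> inv_phi ^ k * (2 * real F - 2)"
      using inv_phi_power_fib_ge[of l] unfolding F_def Suc_k unfolding l .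
    with r_less have "inv_phi ^ k * (2 * r) < inv_phi ^ k * (2 * real F - 2)" by linarith
    then have "real (2 * r) < 2 * real F - 2"
      using inv_phi_power_pos[of k] by (simp only: mult_less_cancel_left_pos)
    then have "r + 2 \<le> F" by linarith
    then have "(r + 2) * m \<le> F * (G - 1)"
      using m by (intro mult_le_mono) (auto simp: G_def)
    also have "\<dots> = F * G - F" by (simp add: diff_mult_distrib2)
    finally have "L + 2 \<le> F * G - F" using r(3) by simp
    moreover have "G < 2 * F" using fib_Suc_bounds[of "Suc k"] k by (simp add: F_def G_def)
    ultimately show ?thesis by linarith
  qed
  ultimately show ?thesis
    using abelian_period_fib[OF k] by (simp add: F_def G_def)
qed

theorem theorem6p9:
  fixes w :: "letter list"
  assumes "is_factor w inf_fib_word" and "w \<noteq> []"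
  shows "\<exists>j. min_abelian_period w = fib (Suc j)"
proof (rule ccontr)
  assume no_fib: "\<nexists>j. min_abelian_period w = fib (Suc j)"
  obtain i j where w: "w = inf_fib_word [i \<rightarrow> j]" using assms(1) by (auto simp: is_factor_def)
  with assms(2) have "i < j" by simp
  with w have w': "w = inf_fib_word [i \<rightarrow> i + (j - i)]" by simp
  have period: "abelian_period (min_abelian_period w) w"
    by (rule abelian_period_min_abelian_period[OF assms(2)])
  \<comment> \<open>The head is strictly shorter than the period, so the period is positive.\<close>
  then have "min_abelian_period w \<ge> 1" by (rule abelian_periodE) simp
  then obtain k where k: "k \<ge> 3" "fib (Suc k) < min_abelian_period w"
    "min_abelian_period w < fib (Suc (Suc k))"
    using between_fibs no_fib by blast
  have "abelian_period (fib (Suc k)) w"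
    using abelian_period_not_fib[of "min_abelian_period w" i "j - i" k] period k w' by simp
  then have "min_abelian_period w \<le> fib (Suc k)"
    unfolding min_abelian_period_def by (rule Least_le)
  with k(2) show False by simp
qed

end
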